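(* For any $P,N>0$, $$\overline{C}_{\mathrm{LD}}(P,N)\coloneqq\lim_{L\to\infty}\overline{C}_{L-1}(P,N)=\frac{1}{2}\ln\frac{P}{N}.$$
   Context: For $r>0$ and $y\in\mathbb{R}^n$, $\mathcal{B}^n(y,r)$ denotes the closed Euclidean ball of radius $r$ centered at $y$, and $\mathcal{B}^n(r)=\mathcal{B}^n(0,r)$. For points $x_1,\dots,x_L\in\mathbb{R}^n$ with centroid $\bar x=\frac1L\sum_i x_i$, the average squared radius is $\overline{\mathrm{rad}}^2(x_1,\dots,x_L)=\frac1L\sum_{i=1}^L\|x_i-\bar x\|_2^2$. Let $P,N>0$ and $L\in\mathbb{Z}_{\ge 2}$. A finite set $\mathcal{C}\subseteq\mathcal{B}^n(\sqrt{nP})$ is a $(P,N,L-1)$-average-radius list-decodable code if every $L$ distinct points of $\mathcal{C}$ have average squared radius strictly greater than $nN$. The rate of $\mathcal{C}$ is $R(\mathcal{C})=\frac1n\ln|\mathcal{C}|$. The $(P,N,L-1)$-average-radius list-decoding capacity is $\overline{C}_{L-1}(P,N)=\limsup_{n\to\infty}\sup\{R(\mathcal{C})\}$, the supremum over all $(P,N,L-1)$-average-radius list-decodable codes $\mathcal{C}\subseteq\mathcal{B}^n(\sqrt{nP})$.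
   Formalization: The limit is stated as max(0, ½ ln(P/N)) instead of ½ ln(P/N): for P < N the stated value is negative, but singleton codes have rate 0, so the capacity is never negative; for P ≥ N the two formulas agree. *)

theory Defs
  imports "HOL-Analysis.Analysis"
begin

text \<open>Points of R^n are represented as functions nat => real vanishing outside {..<n}.\<close>

definition sqnorm :: "nat \<Rightarrow> (nat \<Rightarrow> real) \<Rightarrow> real" where
  "sqnorm n x = (\<Sum>i<n. (x i)\<^sup>2)"

definition in_Rn :: "nat \<Rightarrow> (nat \<Rightarrow> real) \<Rightarrow> bool" where
  "in_Rn n x \<longleftrightarrow> (\<forall>i\<ge>n. x i = 0)"

definition ball_nP :: "nat \<Rightarrow> real \<Rightarrow> (nat \<Rightarrow> real) set" where
  "ball_nP n P = {x. in_Rn n x \<and> sqrt (sqnorm n x) \<le> sqrt (real n * P)}"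

definition centroid :: "(nat \<Rightarrow> real) set \<Rightarrow> (nat \<Rightarrow> real)" where
  "centroid S = (\<lambda>i. (1 / real (card S)) * (\<Sum>x\<in>S. x i))"

definition avg_sq_rad :: "nat \<Rightarrow> (nat \<Rightarrow> real) set \<Rightarrow> real" where
  "avg_sq_rad n S = (1 / real (card S)) * (\<Sum>x\<in>S. sqnorm n (\<lambda>i. x i - centroid S i))"

text \<open>(P,N,L-1)-average-radius list-decodable code in R^n (L = number of points).\<close>
definition avg_rad_LD_code :: "nat \<Rightarrow> real \<Rightarrow> real \<Rightarrow> nat \<Rightarrow> (nat \<Rightarrow> real) set \<Rightarrow> bool" where
  "avg_rad_LD_code n P N L C \<longleftrightarrow> finite C \<and> C \<subseteq> ball_nP n P \<and>
     (\<forall>S\<subseteq>C. card S = L \<longrightarrow> avg_sq_rad n S > real n * N)"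

definition rate :: "nat \<Rightarrow> (nat \<Rightarrow> real) set \<Rightarrow> real" where
  "rate n C = ln (real (card C)) / real n"

text \<open>(P,N,L-1)-average-radius list-decoding capacity (extended real, to be safe
  about unboundedness), indexed by the number L of points.\<close>
definition avg_rad_LD_capacity :: "real \<Rightarrow> real \<Rightarrow> nat \<Rightarrow> ereal" where
  "avg_rad_LD_capacity P N L =
     limsup (\<lambda>n. SUP C\<in>{C. avg_rad_LD_code n P N L C}. ereal (rate n C))"

end

theory Submission
  imports Defs "HOL-Probability.Probability" "HOL-Real_Asymp.Real_Asymp"
begin

text \<open>
  Converse, for \<open>N < P\<close>: a ball of squared radius \<open>n N\<close> contains fewer than \<open>L\<close> codewords. For a
  random centre \<open>y\<close> with i.i.d. Gaussian coordinates of variance \<open>P - N\<close>, every \<open>x\<close> with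
  \<open>|x|\<^sup>2 = n P\<close> satisfies \<open>|x - y|\<^sup>2 \<le> n N\<close> with probability at least \<open>(N / P) ^ (n / 2)\<close> up to a
  subexponential factor, so the code has at most about \<open>L (P / N) ^ (n / 2)\<close> elements. The
  probability is estimated with exponential moments only: the indicator of
  \<open>|x - y|\<^sup>2 \<le> n N\<close> is bounded below by an exponential weight minus two Chernoff weights.

  Achievability: draw Gaussian codewords of variance slightly below \<open>P\<close>, drop the atypical ones, and
  drop one index from each bad \<open>L\<close>-set. Typical points with average squared radius at most \<open>n N\<close>
  have \<open>|\<Sum>x\<^sub>i|\<^sup>2 \<ge> L\<^sup>2 n (P - N)\<close> and \<open>\<Sum>|x\<^sub>i|\<^sup>2 \<le> L n P\<close> approximately. A Chernoff bound that uses both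
  constraints shows that this has probability \<open>exp (- n ((L - 1) / 2 ln (P / N) - O(ln L)))\<close>; using
  the first constraint alone would lose a constant in the rate.
\<close>

section \<open>Gaussian integrals\<close>

definition gauss :: "real measure" where
  "gauss = density lborel std_normal_density"

lemma prob_space_gauss: "prob_space gauss"
  unfolding gauss_def by (rule prob_space_normal_density) simp

lemma sets_gauss [measurable_cong]: "sets gauss = sets borel"
  by (simp add: gauss_def)

text \<open>Completing the square: with \<open>d = 1 + 2 * k\<close> the integrand is a constant
  multiple of the normal density with mean \<open>a / d\<close> and variance \<open>1 / d\<close>,
  whose integral is 1.\<close>

lemma nn_integral_gauss_exp_quadratic:
  assumes "1 + 2 * k > 0"
  shows "(\<integral>\<^sup>+x. ennreal (exp (a * x - k * x\<^sup>2)) \<partial>gauss)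
    = ennreal (exp (a\<^sup>2 / (2 * (1 + 2 * k)) - ln (1 + 2 * k) / 2))"
proof -
  define d where "d = 1 + 2 * k"
  have d: "d > 0" using assms by (simp add: d_def)
  define K where "K = exp (a\<^sup>2 / (2 * d) - ln d / 2)"
  have K: "K = exp (a\<^sup>2 / (2 * d)) * exp (- (ln d / 2))"
    by (simp add: K_def flip: exp_add)
  have pointwise: "std_normal_density x * exp (a * x - k * x\<^sup>2) = K * normal_density (a / d) (1 / sqrt d) x" for x
  proof -
    have k: "k = (d - 1) / 2" by (simp add: d_def)
    have e: "- x\<^sup>2 / 2 + (a * x - k * x\<^sup>2) = a\<^sup>2 / (2 * d) + - (x - a / d)\<^sup>2 / (2 * (1 / sqrt d)\<^sup>2)"
      using d unfolding k by (simp add: power_divide power2_eq_square field_simps)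
    have "exp (- (ln d / 2)) = 1 / sqrt d"
      using d by (simp add: exp_minus ln_sqrt[symmetric] inverse_eq_divide)
    then have s: "exp (- (ln d / 2)) * (1 / sqrt (2 * pi * (1 / sqrt d)\<^sup>2)) = 1 / sqrt (2 * pi)"
      using d by (simp add: power_divide real_sqrt_divide)
    have "std_normal_density x * exp (a * x - k * x\<^sup>2)
        = 1 / sqrt (2 * pi) * exp (- x\<^sup>2 / 2 + (a * x - k * x\<^sup>2))"
      by (simp add: std_normal_density_def flip: exp_add)
    also have "\<dots> = K * normal_density (a / d) (1 / sqrt d) x"
      unfolding e s[symmetric] K exp_add normal_density_def by (simp only: mult_ac)
    finally show ?thesis .
  qed
  interpret n: prob_space "density lborel (normal_density (a / d) (1 / sqrt d))"
    using d by (intro prob_space_normal_density) simp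
  have one: "(\<integral>\<^sup>+x. ennreal (normal_density (a / d) (1 / sqrt d) x) \<partial>lborel) = 1"
    using n.emeasure_space_1 by (simp add: emeasure_density)
  have "(\<integral>\<^sup>+x. ennreal (exp (a * x - k * x\<^sup>2)) \<partial>gauss)
     = (\<integral>\<^sup>+x. ennreal K * ennreal (normal_density (a / d) (1 / sqrt d) x) \<partial>lborel)"
    unfolding gauss_def
    by (subst nn_integral_density) (auto simp: ennreal_mult'[symmetric] pointwise K_def)
  also have "\<dots> = ennreal K"
    by (subst nn_integral_cmult) (auto simp: one)
  finally show ?thesis by (simp add: K_def d_def)
qed

lemma nn_integral_PiM_prod_const:
  assumes "prob_space M" "finite I" "f \<in> borel_measurable M"
  shows "(\<integral>\<^sup>+w. (\<Prod>i\<in>I. f (w i)) \<partial>PiM I (\<lambda>_. M)) = (\<integral>\<^sup>+x. f x \<partial>M) ^ card I"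
proof -
  interpret M: prob_space M by fact
  interpret product_sigma_finite "\<lambda>_. M" by standard
  show ?thesis using assms by (subst product_nn_integral_prod) auto
qed

lemma nn_integral_PiM_gauss_exp_quadratic:
  assumes "finite I" "\<And>i. i \<in> I \<Longrightarrow> 1 + 2 * k i > 0"
  shows "(\<integral>\<^sup>+w. ennreal (exp (\<Sum>i\<in>I. a i * w i - k i * (w i)\<^sup>2)) \<partial>PiM I (\<lambda>_. gauss))
    = ennreal (exp (\<Sum>i\<in>I. (a i)\<^sup>2 / (2 * (1 + 2 * k i)) - ln (1 + 2 * k i) / 2))"
proof -
  interpret M: prob_space gauss by (rule prob_space_gauss)
  interpret product_sigma_finite "\<lambda>_. gauss" by standard
  have "(\<integral>\<^sup>+w. ennreal (exp (\<Sum>i\<in>I. a i * w i - k i * (w i)\<^sup>2)) \<partial>PiM I (\<lambda>_. gauss))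
    = (\<integral>\<^sup>+w. (\<Prod>i\<in>I. ennreal (exp (a i * w i - k i * (w i)\<^sup>2))) \<partial>PiM I (\<lambda>_. gauss))"
    using assms by (simp add: exp_sum prod_ennreal)
  also have "\<dots> = (\<Prod>i\<in>I. \<integral>\<^sup>+x. ennreal (exp (a i * x - k i * x\<^sup>2)) \<partial>gauss)"
    using assms(1) by (intro product_nn_integral_prod) auto
  also have "\<dots> = (\<Prod>i\<in>I. ennreal (exp ((a i)\<^sup>2 / (2 * (1 + 2 * k i)) - ln (1 + 2 * k i) / 2)))"
    using assms by (intro prod.cong refl nn_integral_gauss_exp_quadratic) auto
  finally show ?thesis using assms(1) by (simp add: exp_sum prod_ennreal)
qed

text \<open>Coordinates outside \<open>S\<close> are given the parameters 0 and contribute the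
  factor 1.\<close>

lemma nn_integral_PiM_gauss_exp_quadratic_subset:
  assumes "finite I" "S \<subseteq> I" "1 + 2 * k > 0"
  shows "(\<integral>\<^sup>+w. ennreal (exp (\<Sum>i\<in>S. a * w i - k * (w i)\<^sup>2)) \<partial>PiM I (\<lambda>_. gauss))
    = ennreal (exp (card S * (a\<^sup>2 / (2 * (1 + 2 * k)) - ln (1 + 2 * k) / 2)))"
proof -
  have "(\<Sum>i\<in>I. (if i \<in> S then a else 0) * w i - (if i \<in> S then k else 0) * (w i)\<^sup>2)
     = (\<Sum>i\<in>S. a * w i - k * (w i)\<^sup>2)" for w :: "'a \<Rightarrow> real"
    using assms by (intro sum.mono_neutral_cong_right) auto
  moreover have "(\<Sum>i\<in>I. (if i \<in> S then a else 0)\<^sup>2 / (2 * (1 + 2 * (if i \<in> S then k else 0)))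
        - ln (1 + 2 * (if i \<in> S then k else 0)) / 2)
     = (\<Sum>i\<in>S. a\<^sup>2 / (2 * (1 + 2 * k)) - ln (1 + 2 * k) / 2)"
    using assms by (intro sum.mono_neutral_cong_right) auto
  ultimately show ?thesis
    using nn_integral_PiM_gauss_exp_quadratic[of I "\<lambda>i. if i \<in> S then k else 0" "\<lambda>i. if i \<in> S then a else 0"] assms
    by simp
qed

text \<open>The square of the sum is linearised by \<open>exp (u s\<^sup>2) = E exp (sqrt (2 u) s g)\<close> with an
  auxiliary Gaussian \<open>g\<close>; conditionally on \<open>g\<close> the coordinates are independent.\<close>

lemma nn_integral_PiM_gauss_exp_sum_squared:
  fixes u k :: real
  assumes "finite I" "S \<subseteq> I" "u \<ge> 0" "1 + 2 * k > 0" "2 * card S * u < 1 + 2 * k"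
  shows "(\<integral>\<^sup>+w. ennreal (exp (u * (\<Sum>i\<in>S. w i)\<^sup>2 - k * (\<Sum>i\<in>S. (w i)\<^sup>2))) \<partial>PiM I (\<lambda>_. gauss))
    = ennreal (exp (- (card S / 2 * ln (1 + 2 * k)) - ln (1 - 2 * card S * u / (1 + 2 * k)) / 2))"
proof -
  interpret G: prob_space gauss by (rule prob_space_gauss)
  interpret P: prob_space "PiM I (\<lambda>_. gauss)" by (intro prob_space_PiM prob_space_gauss)
  interpret pair_sigma_finite gauss "PiM I (\<lambda>_. gauss)" by standard
  define b where "b = sqrt (2 * u)"
  have b2: "b\<^sup>2 = 2 * u" using assms by (simp add: b_def)
  have comp: "(\<lambda>w. w i) \<in> borel_measurable (PiM I (\<lambda>_. gauss))" if "i \<in> S" for i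
    using measurable_component_singleton[of i I "\<lambda>_. gauss"] that assms(2)
    by (auto simp: measurable_cong_sets[OF refl sets_gauss])
  have split: "ennreal (exp (u * (\<Sum>i\<in>S. w i)\<^sup>2 - k * (\<Sum>i\<in>S. (w i)\<^sup>2)))
     = (\<integral>\<^sup>+g. ennreal (exp (\<Sum>i\<in>S. (b * g) * w i - k * (w i)\<^sup>2)) \<partial>gauss)" for w
  proof -
    have "(\<integral>\<^sup>+g. ennreal (exp (\<Sum>i\<in>S. (b * g) * w i - k * (w i)\<^sup>2)) \<partial>gauss)
      = (\<integral>\<^sup>+g. ennreal (exp (- (k * (\<Sum>i\<in>S. (w i)\<^sup>2)))) * ennreal (exp ((b * (\<Sum>i\<in>S. w i)) * g - 0 * g\<^sup>2)) \<partial>gauss)"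
      by (intro nn_integral_cong, subst ennreal_mult'[symmetric])
         (auto simp: sum_subtractf sum_distrib_left sum_distrib_right mult_ac simp flip: exp_add)
    also have "\<dots> = ennreal (exp (- (k * (\<Sum>i\<in>S. (w i)\<^sup>2)))) * ennreal (exp ((b * (\<Sum>i\<in>S. w i))\<^sup>2 / 2))"
      by (subst nn_integral_cmult, measurable) (simp add: nn_integral_gauss_exp_quadratic[of 0, simplified])
    also have "\<dots> = ennreal (exp (u * (\<Sum>i\<in>S. w i)\<^sup>2 - k * (\<Sum>i\<in>S. (w i)\<^sup>2)))"
      by (subst ennreal_mult'[symmetric]) (auto simp: power_mult_distrib b2 simp flip: exp_add)
    finally show ?thesis by simp
  qed
  \<comment> \<open>With the coordinates integrated out, the integrand in \<open>g\<close> is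
    \<open>exp (- k' * g\<^sup>2)\<close> up to a constant. The hypothesis on
    \<open>card S * u\<close> is exactly \<open>1 + 2 * k' > 0\<close>.\<close>
  define k' where "k' = - (card S * u / (1 + 2 * k))"
  have k': "1 + 2 * k' > 0" using assms by (simp add: k'_def field_simps)
  have "(\<integral>\<^sup>+w. ennreal (exp (u * (\<Sum>i\<in>S. w i)\<^sup>2 - k * (\<Sum>i\<in>S. (w i)\<^sup>2))) \<partial>PiM I (\<lambda>_. gauss))
    = (\<integral>\<^sup>+g. \<integral>\<^sup>+w. ennreal (exp (\<Sum>i\<in>S. (b * g) * w i - k * (w i)\<^sup>2)) \<partial>PiM I (\<lambda>_. gauss) \<partial>gauss)"
    unfolding split using comp[measurable] by (subst Fubini') (auto simp: case_prod_beta)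
  also have "\<dots> = (\<integral>\<^sup>+g. ennreal (exp (- (card S / 2 * ln (1 + 2 * k)))) * ennreal (exp (0 * g - k' * g\<^sup>2)) \<partial>gauss)"
    using assms
    by (subst nn_integral_PiM_gauss_exp_quadratic_subset)
       (auto simp: k'_def power_mult_distrib b2 field_simps simp flip: exp_add ennreal_mult' intro!: nn_integral_cong)
  also have "\<dots> = ennreal (exp (- (card S / 2 * ln (1 + 2 * k)))) * ennreal (exp (- (ln (1 + 2 * k') / 2)))"
    by (subst nn_integral_cmult) (auto simp: nn_integral_gauss_exp_quadratic[OF k', of 0, simplified])
  finally show ?thesis by (subst (asm) ennreal_mult'[symmetric]) (auto simp: k'_def mult.assoc simp flip: exp_add)
qed

section \<open>Average radius and list size\<close>

lemma sum_square_deviation: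
  fixes f :: "'a \<Rightarrow> real"
  assumes "finite S" "S \<noteq> {}"
  shows "(\<Sum>x\<in>S. (f x - 1 / card S * (\<Sum>x\<in>S. f x))\<^sup>2) = (\<Sum>x\<in>S. (f x)\<^sup>2) - (\<Sum>x\<in>S. f x)\<^sup>2 / card S"
proof -
  define c where "c = 1 / card S * (\<Sum>x\<in>S. f x)"
  have c: "card S * c = (\<Sum>x\<in>S. f x)" using assms by (simp add: c_def)
  have "(\<Sum>x\<in>S. (f x - c)\<^sup>2) = (\<Sum>x\<in>S. (f x)\<^sup>2) - 2 * c * (\<Sum>x\<in>S. f x) + card S * c\<^sup>2"
    by (simp add: power2_diff sum.distrib sum_subtractf flip: sum_distrib_left sum_distrib_right)
  also have "\<dots> = (\<Sum>x\<in>S. (f x)\<^sup>2) - (card S * c)\<^sup>2 / card S"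
    using assms unfolding c[symmetric] by (simp add: power2_eq_square field_simps)
  finally show ?thesis unfolding c unfolding c_def .
qed

text \<open>The variance identity, summed over coordinates. For points of nearly known norm it turns
  a small average radius into a long vector sum, which is the event estimated for random
  codes.\<close>

lemma card_times_avg_sq_rad:
  assumes "finite S" "S \<noteq> {}"
  shows "card S * avg_sq_rad n S
    = (\<Sum>x\<in>S. sqnorm n x) - sqnorm n (\<lambda>i. \<Sum>x\<in>S. x i) / card S"
proof -
  have "card S * avg_sq_rad n S = (\<Sum>i<n. \<Sum>x\<in>S. (x i - 1 / card S * (\<Sum>x\<in>S. x i))\<^sup>2)"
    using assms unfolding avg_sq_rad_def sqnorm_def centroid_def by (simp add: sum.swap[of _ S])
  also have "\<dots> = (\<Sum>i<n. (\<Sum>x\<in>S. (x i)\<^sup>2) - (\<Sum>x\<in>S. x i)\<^sup>2 / card S)"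
    using assms by (intro sum.cong refl sum_square_deviation)
  finally show ?thesis
    unfolding sqnorm_def by (simp add: sum_subtractf sum.swap[of _ S] sum_divide_distrib)
qed

text \<open>The centroid minimises the sum of squared distances in each coordinate: replacing it by
  \<open>y\<close> adds \<open>card S * (c i - y i)\<^sup>2\<close>.\<close>

lemma avg_sq_rad_le:
  assumes "finite S" "S \<noteq> {}" "\<And>x. x \<in> S \<Longrightarrow> sqnorm n (\<lambda>i. x i - y i) \<le> r"
  shows "avg_sq_rad n S \<le> r"
proof -
  define c where "c i = 1 / card S * (\<Sum>x\<in>S. x i)" for i
  have c: "(\<Sum>x\<in>S. x i) = card S * c i" for i using assms by (simp add: c_def)
  have le: "(\<Sum>x\<in>S. (x i - c i)\<^sup>2) \<le> (\<Sum>x\<in>S. (x i - y i)\<^sup>2)" for i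
  proof -
    have "(\<Sum>x\<in>S. (x i - y i)\<^sup>2) = (\<Sum>x\<in>S. (x i - c i)\<^sup>2 + 2 * (c i - y i) * x i + ((y i)\<^sup>2 - (c i)\<^sup>2))"
      by (intro sum.cong refl) (simp add: power2_eq_square algebra_simps)
    also have "\<dots> = (\<Sum>x\<in>S. (x i - c i)\<^sup>2) + card S * (c i - y i)\<^sup>2"
      by (simp add: sum.distrib flip: sum_distrib_left) (simp add: c power2_eq_square algebra_simps)
    finally show ?thesis by simp
  qed
  have "card S * avg_sq_rad n S = (\<Sum>i<n. \<Sum>x\<in>S. (x i - c i)\<^sup>2)"
    using assms unfolding avg_sq_rad_def sqnorm_def centroid_def c_def by (simp add: sum.swap[of _ S])
  also have "\<dots> \<le> (\<Sum>i<n. \<Sum>x\<in>S. (x i - y i)\<^sup>2)"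
    by (intro sum_mono le)
  also have "\<dots> = (\<Sum>x\<in>S. sqnorm n (\<lambda>i. x i - y i))"
    unfolding sqnorm_def by (rule sum.swap)
  also have "\<dots> \<le> card S * r"
    using sum_bounded_above[of S _ r] assms by auto
  finally show ?thesis using assms by (simp add: card_gt_0_iff)
qed

text \<open>Average-radius list decodability implies ordinary list decodability, since
  \<open>L\<close> codewords in one such ball would have average squared radius at most
  \<open>n * N\<close>. Of the radius condition, the converse uses only this consequence.\<close>

lemma avg_rad_LD_code_card_ball:
  assumes "avg_rad_LD_code n P N L C" "L > 0"
  shows "card {x \<in> C. sqnorm n (\<lambda>i. x i - y i) \<le> n * N} < L"
proof (rule ccontr)
  assume "\<not> ?thesis"
  then obtain S where S: "S \<subseteq> {x \<in> C. sqnorm n (\<lambda>i. x i - y i) \<le> n * N}" "card S = L" "finite S"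
    by (meson not_less obtain_subset_with_card_n)
  then have "avg_sq_rad n S \<le> n * N"
    using assms(2) by (intro avg_sq_rad_le[where y = y]) auto
  moreover have "avg_sq_rad n S > n * N"
    using assms(1) S by (auto simp: avg_rad_LD_code_def)
  ultimately show False by simp
qed

lemma sqnorm_le_of_ball_nP: "x \<in> ball_nP n P \<Longrightarrow> sqnorm n x \<le> n * P"
  by (simp add: ball_nP_def)

section \<open>The converse bound\<close>

text \<open>Expanding the square gives a linear plus quadratic form in \<open>w\<close>, so the
  Gaussian moment formula applies. The value depends on \<open>x\<close> only through its norm,
  which makes codewords on a common sphere interchangeable.\<close>

lemma nn_integral_gauss_exp_dist:
  fixes x :: "nat \<Rightarrow> real"
  assumes "1 + 2 * t * s\<^sup>2 > 0" "finite I"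
  shows "(\<integral>\<^sup>+w. ennreal (exp (- (t * (\<Sum>i\<in>I. (x i - s * w i)\<^sup>2)))) \<partial>PiM I (\<lambda>_. gauss))
    = ennreal (exp (- (t * (\<Sum>i\<in>I. (x i)\<^sup>2) / (1 + 2 * t * s\<^sup>2)) - card I * ln (1 + 2 * t * s\<^sup>2) / 2))"
proof -
  interpret P: prob_space "PiM I (\<lambda>_. gauss)" by (intro prob_space_PiM prob_space_gauss)
  define d where "d = 1 + 2 * t * s\<^sup>2"
  have d: "d > 0" using assms by (simp add: d_def)
  have "(\<integral>\<^sup>+w. ennreal (exp (- (t * (\<Sum>i\<in>I. (x i - s * w i)\<^sup>2)))) \<partial>PiM I (\<lambda>_. gauss))
    = (\<integral>\<^sup>+w. ennreal (exp (- (t * (\<Sum>i\<in>I. (x i)\<^sup>2)))) *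
         ennreal (exp (\<Sum>i\<in>I. (2 * t * s * x i) * w i - (t * s\<^sup>2) * (w i)\<^sup>2)) \<partial>PiM I (\<lambda>_. gauss))"
    by (intro nn_integral_cong, subst ennreal_mult'[symmetric])
       (auto simp: power2_eq_square algebra_simps sum.distrib sum_subtractf sum_distrib_left simp flip: exp_add)
  also have "\<dots> = ennreal (exp (- (t * (\<Sum>i\<in>I. (x i)\<^sup>2)))) *
      ennreal (exp (\<Sum>i\<in>I. (2 * t * s * x i)\<^sup>2 / (2 * d) - ln d / 2))"
    using nn_integral_PiM_gauss_exp_quadratic[of I "\<lambda>_. t * s\<^sup>2" "\<lambda>i. 2 * t * s * x i"] assms
    by (subst nn_integral_cmult, measurable) (simp only: mult.assoc d_def)
  also have "\<dots> = ennreal (exp (- (t * (\<Sum>i\<in>I. (x i)\<^sup>2)) + ((2 * t * s)\<^sup>2 / (2 * d) * (\<Sum>i\<in>I. (x i)\<^sup>2) - card I * ln d / 2)))"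
    by (simp add: sum_subtractf sum_distrib_left power_mult_distrib sum_divide_distrib mult.assoc flip: exp_add ennreal_mult')
  also have "- (t * (\<Sum>i\<in>I. (x i)\<^sup>2)) + ((2 * t * s)\<^sup>2 / (2 * d) * (\<Sum>i\<in>I. (x i)\<^sup>2) - card I * ln d / 2)
     = - (t * (\<Sum>i\<in>I. (x i)\<^sup>2) / d) - card I * ln d / 2"
  proof -
    have "(2 * t * s)\<^sup>2 = 2 * (t * (d - 1))"
      by (simp add: d_def power2_eq_square)
    then have eq: "(2 * t * s)\<^sup>2 / (2 * d) = t - t / d"
      using d by (simp add: diff_divide_distrib right_diff_distrib)
    show ?thesis unfolding eq by (simp add: algebra_simps)
  qed
  finally show ?thesis by (simp add: d_def)
qed

text \<open>For \<open>m' \<le> Z \<le> m\<close> the left side is at most 1 because its exponent is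
  nonpositive; outside this window one of the last two terms already dominates it.\<close>

lemma indicator_ge_exponential_window:
  fixes Z :: real
  assumes "h \<ge> 0" "t \<ge> 0"
  shows "exp (h * (m' - Z)) \<le> (if Z \<le> m then 1 else 0) + exp (h * (m' - Z) + t * (Z - m)) + exp (h * (m' - Z) + t * (m' - Z))"
proof (cases "Z \<le> m \<and> m' \<le> Z")
  case True
  then have "exp (h * (m' - Z)) \<le> 1" using assms by (simp add: mult_nonneg_nonpos)
  then show ?thesis using True by (simp add: add_increasing2)
next
  case False
  then consider "Z > m" | "m' > Z" by linarith
  then show ?thesis
  proof cases
    case 1
    then have "exp (h * (m' - Z)) \<le> exp (h * (m' - Z) + t * (Z - m))" using assms by simp
    then show ?thesis by (smt (verit, best) exp_gt_zero)
  next
    case 2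
    then have "exp (h * (m' - Z)) \<le> exp (h * (m' - Z) + t * (m' - Z))" using assms by simp
    then show ?thesis by (smt (verit, best) exp_gt_zero)
  qed
qed

text \<open>Every codeword is extended by one coordinate so that it lies on the sphere of radius
  \<open>sqrt (n P)\<close>; all its Gaussian moments then depend on the radius only.\<close>

lemma avg_rad_LD_code_card_le:
  fixes P N V h t m' :: real and n :: nat
  defines "I \<equiv> \<lambda>h. exp (- (h * (n * P) / (1 + 2 * h * V)) - Suc n * ln (1 + 2 * h * V) / 2)"
  assumes code: "avg_rad_LD_code n P N L C" and "L > 0" "V \<ge> 0" "0 \<le> t" "t \<le> h"
  shows "card C * (exp (h * m') * I h) \<le> L + card C * (exp (h * m' - t * (n * N)) * I (h - t))
    + card C * (exp ((h + t) * m') * I (h + t))"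
proof -
  have fC: "finite C" and ball: "C \<subseteq> ball_nP n P" using code by (auto simp: avg_rad_LD_code_def)
  define s where "s = sqrt V"
  have s: "s\<^sup>2 = V" using assms by (simp add: s_def)
  \<comment> \<open>One Gaussian coordinate more than the dimension \<open>n\<close>, to match the
    coordinate added to the codewords.\<close>
  let ?M = "PiM {..<Suc n} (\<lambda>_. gauss)"
  interpret P: prob_space ?M by (intro prob_space_PiM prob_space_gauss)
  define e where "e x = x(n := sqrt (n * P - sqnorm n x))" for x :: "nat \<Rightarrow> real"
  define Z where "Z x w = (\<Sum>i<Suc n. (e x i - s * w i)\<^sup>2)" for x w
  have e: "(\<Sum>i<Suc n. (e x i)\<^sup>2) = n * P" if "x \<in> C" for x
    using sqnorm_le_of_ball_nP[of x n P] that ball by (auto simp: e_def sqnorm_def)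
  have mZ [measurable]: "Z x \<in> borel_measurable ?M" for x
    unfolding Z_def by measurable
  have int: "(\<integral>\<^sup>+w. ennreal (exp (c - q * Z x w)) \<partial>?M) = ennreal (exp c * I q)"
    if "x \<in> C" "q \<ge> 0" for x c q
  proof -
    have d: "1 + 2 * q * s\<^sup>2 > 0" using that assms unfolding s by (simp add: add_pos_nonneg)
    have "(\<integral>\<^sup>+w. ennreal (exp (c - q * Z x w)) \<partial>?M)
      = (\<integral>\<^sup>+w. ennreal (exp c) * ennreal (exp (- (q * Z x w))) \<partial>?M)"
      by (simp add: exp_add[symmetric] flip: ennreal_mult')
    also have "\<dots> = ennreal (exp c) * ennreal (I q)"
      using nn_integral_gauss_exp_dist[OF d, of "{..<Suc n}" "e x"] that
      by (subst nn_integral_cmult, measurable) (simp only: Z_def[symmetric] e s I_def finite_lessThan card_lessThan)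
    finally show ?thesis by (simp add: ennreal_mult')
  qed
  have I0: "I q \<ge> 0" for q by (simp add: I_def)
  \<comment> \<open>Forgetting the added coordinate does not increase the distance, so the list-size
    bound in dimension \<open>n\<close> controls the events
    \<open>Z x w \<le> n * N\<close>.\<close>
  have near: "sqnorm n (\<lambda>i. x i - s * w i) \<le> Z x w" for x w
    unfolding sqnorm_def Z_def e_def by simp
  \<comment> \<open>For every fixed centre fewer than \<open>L\<close> indicators equal 1, so
    summing the window inequality over the code costs only the term \<open>L\<close>. Integration
    over \<open>w\<close> then gives the claim.\<close>
  have pointwise: "(\<Sum>x\<in>C. exp (h * m' - h * Z x w))
    \<le> L + (\<Sum>x\<in>C. exp ((h * m' - t * (n * N)) - (h - t) * Z x w)) + (\<Sum>x\<in>C. exp ((h + t) * m' - (h + t) * Z x w))" for w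
  proof -
    have "{x \<in> C. Z x w \<le> n * N} \<subseteq> {x \<in> C. sqnorm n (\<lambda>i. x i - s * w i) \<le> n * N}"
      using near order_trans by blast
    then have "card {x \<in> C. Z x w \<le> n * N} \<le> card {x \<in> C. sqnorm n (\<lambda>i. x i - s * w i) \<le> n * N}"
      using fC by (intro card_mono) auto
    also have "\<dots> < L" by (rule avg_rad_LD_code_card_ball[OF code \<open>L > 0\<close>])
    finally have "(\<Sum>x\<in>C. if Z x w \<le> n * N then 1 else 0 :: real) \<le> L"
      using fC by (simp add: sum.If_cases Int_def)
    moreover have "(\<Sum>x\<in>C. exp (h * m' - h * Z x w)) \<le> (\<Sum>x\<in>C. (if Z x w \<le> n * N then 1 else 0) +
       exp ((h * m' - t * (n * N)) - (h - t) * Z x w) + exp ((h + t) * m' - (h + t) * Z x w))"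
      using indicator_ge_exponential_window[of h t m' "Z _ w" "n * N"] assms
      by (intro sum_mono) (simp add: algebra_simps)
    ultimately show ?thesis by (simp add: sum.distrib)
  qed
  have "(\<integral>\<^sup>+w. (\<Sum>x\<in>C. ennreal (exp (h * m' - h * Z x w))) \<partial>?M)
    \<le> (\<integral>\<^sup>+w. ennreal L + (\<Sum>x\<in>C. ennreal (exp ((h * m' - t * (n * N)) - (h - t) * Z x w)))
        + (\<Sum>x\<in>C. ennreal (exp ((h + t) * m' - (h + t) * Z x w))) \<partial>?M)"
    using pointwise by (intro nn_integral_mono) (simp add: sum_ennreal sum_nonneg ennreal_leI flip: ennreal_plus)
  also have "\<dots> = ennreal L + (\<Sum>x\<in>C. ennreal (exp (h * m' - t * (n * N)) * I (h - t)))
        + (\<Sum>x\<in>C. ennreal (exp ((h + t) * m') * I (h + t)))"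
    using \<open>0 \<le> t\<close> \<open>t \<le> h\<close>
    by (simp add: nn_integral_add nn_integral_sum int P.emeasure_space_1 del: sum_ennreal)
  also have "(\<integral>\<^sup>+w. (\<Sum>x\<in>C. ennreal (exp (h * m' - h * Z x w))) \<partial>?M) = (\<Sum>x\<in>C. ennreal (exp (h * m') * I h))"
    using \<open>0 \<le> t\<close> \<open>t \<le> h\<close> by (simp add: nn_integral_sum int del: sum_ennreal)
  finally have "ennreal (card C * (exp (h * m') * I h)) \<le> ennreal L + ennreal (card C * (exp (h * m' - t * (n * N)) * I (h - t)))
    + ennreal (card C * (exp ((h + t) * m') * I (h + t)))"
    by (simp add: I0 ennreal_mult' ennreal_of_nat_eq_real_of_nat)
  then show ?thesis
    by (subst (asm) ennreal_plus[symmetric], simp, simp add: I0, subst (asm) ennreal_plus[symmetric])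
       (auto simp: I0 ennreal_le_iff simp del: ennreal_plus)
qed

section \<open>Exponents of the converse and the upper bound on the capacity\<close>

text \<open>The preceding bound is applied with variance \<open>P - Q\<close> and window
  \<open>n * (Q - \<delta>) \<le> Z \<le> n * N\<close>, where \<open>Q = N - \<delta>\<close>. Both
  correction terms are exponentially smaller than the main term, which alone then bounds the rate.
  The last summand is the price of placing the lower edge of the window below
  \<open>n * Q\<close>.\<close>

lemma avg_rad_LD_capacity_le_slack:
  fixes P N :: real
  assumes "0 < N" "N < P" "L > 0" "0 < \<delta>" "\<delta> < N"
  shows "avg_rad_LD_capacity P N L \<le> ereal (1 / 2 * ln (P / (N - \<delta>)) + \<delta> / (2 * (N - \<delta>)))"
proof -
  define Q where "Q = N - \<delta>"
  have Q: "0 < Q" "Q < P" "N = Q + \<delta>" using assms by (auto simp: Q_def)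
  define V where "V = P - Q"
  have V: "V > 0" using Q by (simp add: V_def)
  \<comment> \<open>This tilt makes the mean of \<open>Z / n\<close> under the tilted measure
    asymptotically \<open>Q\<close>; equivalently, the log-moment function \<open>g\<close> below
    has derivative \<open>- Q\<close> at \<open>h\<close>.\<close>
  define h where "h = 1 / (2 * Q)"
  have h: "h > 0" using Q by (simp add: h_def)
  have d: "1 + 2 * h * V = P / Q" using Q by (simp add: h_def V_def field_simps)
  define g where "g h = - (h * P / (1 + 2 * h * V)) - ln (1 + 2 * h * V) / 2" for h
  have gh: "g h = - (1 / 2) - ln (P / Q) / 2"
    using Q unfolding g_def d by (simp add: h_def)
  have g': "(g has_real_derivative - Q) (at h)"
  proof -
    have pos: "1 + 2 * h * V > 0" using Q by (simp add: d)
    have "(g has_real_derivative - ((P * (1 + 2 * h * V) - h * P * (2 * V)) / (1 + 2 * h * V)\<^sup>2) - V / (1 + 2 * h * V)) (at h)"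
      unfolding g_def using pos
      by (auto intro!: derivative_eq_intros simp: power2_eq_square) (auto simp: divide_simps)
    also have "- ((P * (1 + 2 * h * V) - h * P * (2 * V)) / (1 + 2 * h * V)\<^sup>2) - V / (1 + 2 * h * V) = - Q"
      using Q unfolding d by (simp add: h_def V_def power2_eq_square field_simps)
    finally show ?thesis .
  qed
  \<comment> \<open>\<open>F1\<close> and \<open>F2\<close> are the exponents of the corrections at
    the upper and lower window edges, up to the common summand \<open>h * (Q - \<delta>)\<close>.
    Both start at \<open>g h\<close> with slope \<open>- \<delta>\<close>, because the edges lie at
    distance \<open>\<delta>\<close> on either side of \<open>Q\<close>.\<close>
  define F1 where "F1 t = - (t * N) + g (h - t)" for t
  define F2 where "F2 t = t * (Q - \<delta>) + g (h + t)" for t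
  have "((\<lambda>t. g (h - t)) has_real_derivative - Q * - 1) (at 0)"
    by (rule DERIV_chain2[where g = "\<lambda>t. h - t"]) (use g' in \<open>auto intro!: derivative_eq_intros\<close>)
  then have F1': "(F1 has_real_derivative - \<delta>) (at 0)"
    unfolding F1_def by (auto intro!: derivative_eq_intros simp: Q)
  obtain d1 where d1: "d1 > 0" "\<And>t. 0 < t \<Longrightarrow> t < d1 \<Longrightarrow> F1 t < F1 0"
    using DERIV_neg_dec_right[OF F1'] assms by auto
  have "((\<lambda>t. g (h + t)) has_real_derivative - Q * 1) (at 0)"
    by (rule DERIV_chain2[where g = "\<lambda>t. h + t"]) (use g' in \<open>auto intro!: derivative_eq_intros\<close>)
  then have F2': "(F2 has_real_derivative - \<delta>) (at 0)"
    unfolding F2_def by (auto intro!: derivative_eq_intros simp: Q)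
  obtain d2 where d2: "d2 > 0" "\<And>t. 0 < t \<Longrightarrow> t < d2 \<Longrightarrow> F2 t < F2 0"
    using DERIV_neg_dec_right[OF F2'] assms by auto
  define t where "t = min (min d1 d2) h / 2"
  have t: "0 < t" "t < d1" "t < d2" "t < h" using d1 d2 h by (auto simp: t_def min_def)
  define A where "A = h * (Q - \<delta>) + g h"
  define B1 where "B1 = h * (Q - \<delta>) + F1 t"
  define B2 where "B2 = h * (Q - \<delta>) + F2 t"
  define a1 where "a1 = B1 - A"
  define a2 where "a2 = B2 - A"
  have a: "a1 < 0" "a2 < 0"
    using d1(2)[of t] d2(2)[of t] t by (auto simp: A_def B1_def B2_def a1_def a2_def F1_def F2_def)
  \<comment> \<open>The added coordinate contributes this further factor, which does not depend on
    \<open>n\<close>.\<close>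
  define c where "c h = exp (- (ln (1 + 2 * h * V) / 2))" for h
  have c: "c q > 0" for q by (simp add: c_def)
  have A: "A = - (1 / 2 * ln (P / Q) + \<delta> / (2 * Q))"
    using Q unfolding A_def gh by (simp add: h_def field_simps)
  have bound: "card C * (c h * exp (n * A)) \<le> L + card C * (c (h - t) * exp (n * B1)) + card C * (c (h + t) * exp (n * B2))"
    if "avg_rad_LD_code n P N L C" for n C
  proof -
    define I where "I h = exp (- (h * (n * P) / (1 + 2 * h * V)) - Suc n * ln (1 + 2 * h * V) / 2)" for h
    have I: "I q = c q * exp (n * g q)" for q
      unfolding I_def c_def g_def exp_add[symmetric] by (simp add: algebra_simps add_divide_distrib)
    have "card C * (exp (h * (n * (Q - \<delta>))) * I h) \<le> L + card C * (exp (h * (n * (Q - \<delta>)) - t * (n * N)) * I (h - t))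
      + card C * (exp ((h + t) * (n * (Q - \<delta>))) * I (h + t))"
      unfolding I_def using that assms V t by (intro avg_rad_LD_code_card_le) auto
    moreover have "exp (h * (n * (Q - \<delta>))) * I h = c h * exp (n * A)"
      unfolding I A_def by (simp add: algebra_simps flip: exp_add)
    moreover have "exp (h * (n * (Q - \<delta>)) - t * (n * N)) * I (h - t) = c (h - t) * exp (n * B1)"
      unfolding I B1_def F1_def by (simp add: algebra_simps flip: exp_add)
    moreover have "exp ((h + t) * (n * (Q - \<delta>))) * I (h + t) = c (h + t) * exp (n * B2)"
      unfolding I B2_def F2_def by (simp add: algebra_simps flip: exp_add)
    ultimately show ?thesis by simp
  qed
  have lim: "((\<lambda>n. exp (real n * a)) \<longlongrightarrow> 0) sequentially" if "a < 0" for a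
    using that by real_asymp
  have "((\<lambda>n. c (h - t) * exp (real n * a1) + c (h + t) * exp (real n * a2)) \<longlongrightarrow> 0) sequentially"
    by (rule tendsto_eq_intros lim a refl | simp)+
  then have ev: "\<forall>\<^sub>F n in sequentially. c (h - t) * exp (real n * a1) + c (h + t) * exp (real n * a2) < c h / 2"
    using c[of h] by (intro order_tendstoD) auto
  have rate_le: "rate n C \<le> ln (2 * L / c h) / n - A"
    if n: "c (h - t) * exp (real n * a1) + c (h + t) * exp (real n * a2) < c h / 2" "n > 0"
      and C: "avg_rad_LD_code n P N L C" for n C
  proof (cases "card C = 0")
    case True
    \<comment> \<open>The empty code has rate 0 because \<open>ln 0 = 0\<close>, so here the bound
      itself has to be nonnegative.\<close>
    have "c h \<le> 1" using Q by (simp add: c_def d)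
    then have "c h \<le> 2 * L" using assms by linarith
    then have "2 * L / c h \<ge> 1" using c[of h] by simp
    moreover have "ln (P / Q) \<ge> 0" "\<delta> / (2 * Q) \<ge> 0" using assms Q by auto
    then have "A \<le> 0" by (simp add: A)
    ultimately show ?thesis using True by (simp add: rate_def order_trans[of A 0])
  next
    case False
    have e: "exp (n * B1) = exp (n * a1) * exp (n * A)" "exp (n * B2) = exp (n * a2) * exp (n * A)"
      by (simp_all add: a1_def a2_def algebra_simps flip: exp_add)
    have "card C * (c h * exp (n * A)) \<le> L + card C * (c (h - t) * exp (n * a1) + c (h + t) * exp (n * a2)) * exp (n * A)"
      using bound[OF C] unfolding e by (simp add: algebra_simps)
    \<comment> \<open>For such \<open>n\<close> the two corrections together take up at most half of
      the main term.\<close>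
    also have "\<dots> \<le> L + card C * (c h / 2) * exp (n * A)"
      using n by (intro add_left_mono mult_right_mono mult_left_mono) auto
    finally have "card C * c h / 2 * exp (n * A) \<le> L" by simp
    then have "card C \<le> 2 * L / c h * exp (- (n * A))"
      using c[of h] by (simp add: exp_minus field_simps)
    then have "ln (card C) \<le> ln (2 * L / c h * exp (- (n * A)))"
      using False by (subst ln_le_cancel_iff) (use c[of h] assms in auto)
    also have "\<dots> = ln (2 * L / c h) - n * A"
      using c[of h] assms by (subst ln_mult) auto
    finally have "rate n C \<le> (ln (2 * L / c h) - n * A) / n"
      unfolding rate_def by (intro divide_right_mono) auto
    then show ?thesis using n(2) by (simp add: diff_divide_distrib)
  qed
  have "avg_rad_LD_capacity P N L \<le> limsup (\<lambda>n. ereal (ln (2 * L / c h) / n - A))"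
    unfolding avg_rad_LD_capacity_def
  proof (rule Limsup_mono)
    show "\<forall>\<^sub>F n in sequentially. (SUP C\<in>{C. avg_rad_LD_code n P N L C}. ereal (rate n C)) \<le> ereal (ln (2 * L / c h) / n - A)"
      using ev eventually_gt_at_top[of 0]
    proof eventually_elim
      case (elim n)
      then show ?case using rate_le by (auto intro!: SUP_least simp del: less_divide_eq_numeral1)
    qed
  qed
  also have "\<dots> = ereal (- A)"
  proof (rule lim_imp_Limsup)
    have "((\<lambda>n. ln (2 * L / c h) / real n - A) \<longlongrightarrow> 0 - A) sequentially"
      by (intro tendsto_intros)
    then show "((\<lambda>n. ereal (ln (2 * L / c h) / real n - A)) \<longlongrightarrow> ereal (- A)) sequentially" by simp
  qed simp
  finally show ?thesis unfolding A Q_def minus_minus .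
qed

lemma avg_rad_LD_capacity_le:
  fixes P N :: real
  assumes "0 < N" "N < P" "L > 0"
  shows "avg_rad_LD_capacity P N L \<le> ereal (1 / 2 * ln (P / N))"
proof (rule tendsto_lowerbound)
  have "((\<lambda>\<delta>. 1 / 2 * ln (P / (N - \<delta>)) + \<delta> / (2 * (N - \<delta>))) \<longlongrightarrow> 1 / 2 * ln (P / (N - 0)) + 0 / (2 * (N - 0))) (at_right 0)"
    using assms by (intro tendsto_intros) auto
  then show "((\<lambda>\<delta>. ereal (1 / 2 * ln (P / (N - \<delta>)) + \<delta> / (2 * (N - \<delta>)))) \<longlongrightarrow> ereal (1 / 2 * ln (P / N))) (at_right 0)"
    by simp
  show "\<forall>\<^sub>F \<delta> in at_right 0. avg_rad_LD_capacity P N L \<le> ereal (1 / 2 * ln (P / (N - \<delta>)) + \<delta> / (2 * (N - \<delta>)))"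
    using eventually_at_right_less[of 0] eventually_at_right_real[OF assms(1)]
  proof eventually_elim
    case (elim \<delta>)
    then show ?case using assms by (intro avg_rad_LD_capacity_le_slack) auto
  qed
qed simp

section \<open>Trivial bounds on the capacity\<close>

text \<open>The ball of squared radius \<open>n * N\<close> about the origin contains the whole
  code, which therefore has fewer than \<open>L\<close> elements.\<close>

lemma avg_rad_LD_capacity_le_0:
  fixes P N :: real
  assumes "P \<le> N" "L > 0"
  shows "avg_rad_LD_capacity P N L \<le> 0"
proof -
  have rate_le: "rate n C \<le> ln L / n" if C: "avg_rad_LD_code n P N L C" for n C
  proof -
    have fC: "finite C" "C \<subseteq> ball_nP n P" using C by (auto simp: avg_rad_LD_code_def)
    have "sqnorm n x \<le> n * N" if "x \<in> C" for x
      using sqnorm_le_of_ball_nP[of x n P] fC that assms mult_left_mono[of P N "real n"] by force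
    then have "{x \<in> C. sqnorm n (\<lambda>i. x i - 0) \<le> n * N} = C" by auto
    then have "card C < L" using avg_rad_LD_code_card_ball[OF C assms(2), of "\<lambda>_. 0"] by simp
    then have "ln (card C) \<le> ln L"
      using assms by (cases "card C = 0") auto
    then show ?thesis by (simp add: rate_def divide_right_mono)
  qed
  have "avg_rad_LD_capacity P N L \<le> limsup (\<lambda>n. ereal (ln L / n))"
    unfolding avg_rad_LD_capacity_def by (intro Limsup_mono always_eventually) (auto intro!: SUP_least rate_le)
  also have "\<dots> = ereal 0"
  proof (rule lim_imp_Limsup)
    have "((\<lambda>n. ln L / real n) \<longlongrightarrow> 0) sequentially" by real_asymp
    then show "((\<lambda>n. ereal (ln L / real n)) \<longlongrightarrow> ereal 0) sequentially" by simp
  qed simp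
  finally show ?thesis by (simp add: zero_ereal_def)
qed

text \<open>The empty code is admissible since \<open>L > 0\<close>, and its rate is 0 by the
  convention \<open>ln 0 = 0\<close>. The maximum with 0 in the limit reflects this.\<close>

lemma avg_rad_LD_capacity_nonneg:
  assumes "L > 0"
  shows "avg_rad_LD_capacity P N L \<ge> 0"
proof -
  have "avg_rad_LD_code n P N L {}" for n
    using assms by (auto simp: avg_rad_LD_code_def)
  then have "(SUP C\<in>{C. avg_rad_LD_code n P N L C}. ereal (rate n C)) \<ge> 0" for n
    by (intro SUP_upper2[of "{}"]) (auto simp: rate_def)
  then show ?thesis
    unfolding avg_rad_LD_capacity_def
    by (intro order_trans[OF _ Liminf_le_Limsup] Liminf_bounded) auto
qed

section \<open>Random Gaussian codes\<close>

text \<open>In \<open>w j i\<close> the index \<open>j\<close> runs over coordinates and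
  \<open>i\<close> over codewords. The exponent is a sum over \<open>j\<close> of identical
  expressions in independent rows, so the integral is the \<open>n\<close>-th power of a one-row
  integral.\<close>

lemma nn_integral_gauss_matrix_exp:
  fixes V u k c s :: real and n m :: nat
  assumes "s\<^sup>2 = V" "S \<subseteq> {..<m}" "u \<ge> 0" "1 + 2 * k * V > 0" "2 * card S * u * V < 1 + 2 * k * V"
  shows "(\<integral>\<^sup>+w. ennreal (exp (n * c + u * sqnorm n (\<lambda>j. \<Sum>i\<in>S. s * w j i) - k * (\<Sum>i\<in>S. sqnorm n (\<lambda>j. s * w j i))))
      \<partial>PiM {..<n} (\<lambda>_. PiM {..<m} (\<lambda>_. gauss)))
    = ennreal (exp (n * (c - card S / 2 * ln (1 + 2 * k * V) - ln (1 - 2 * card S * u * V / (1 + 2 * k * V)) / 2)))"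
proof -
  let ?G = "PiM {..<m} (\<lambda>_. gauss)"
  interpret G: prob_space ?G by (intro prob_space_PiM prob_space_gauss)
  define f where "f v = exp (c + (u * V) * (\<Sum>i\<in>S. v i)\<^sup>2 - (k * V) * (\<Sum>i\<in>S. (v i)\<^sup>2))" for v :: "nat \<Rightarrow> real"
  have V: "V \<ge> 0" using assms(1) by auto
  have comp [measurable]: "(\<lambda>v. v i) \<in> borel_measurable ?G" if "i \<in> S" for i
    using measurable_component_singleton[of i "{..<m}" "\<lambda>_. gauss"] that assms(2)
    by (auto simp: measurable_cong_sets[OF refl sets_gauss])
  have [measurable]: "f \<in> borel_measurable ?G"
    unfolding f_def by measurable
  have one: "(\<integral>\<^sup>+v. ennreal (f v) \<partial>?G)
    = ennreal (exp (c - card S / 2 * ln (1 + 2 * k * V) - ln (1 - 2 * card S * u * V / (1 + 2 * k * V)) / 2))"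
  proof -
    have "(\<integral>\<^sup>+v. ennreal (f v) \<partial>?G) = (\<integral>\<^sup>+v. ennreal (exp c) *
        ennreal (exp ((u * V) * (\<Sum>i\<in>S. v i)\<^sup>2 - (k * V) * (\<Sum>i\<in>S. (v i)\<^sup>2))) \<partial>?G)"
      by (simp add: f_def add_diff_eq flip: ennreal_mult' exp_add)
    also have "\<dots> = ennreal (exp c) * ennreal (exp (- (card S / 2 * ln (1 + 2 * (k * V)))
        - ln (1 - 2 * card S * (u * V) / (1 + 2 * (k * V))) / 2))"
      using assms V
      by (subst nn_integral_cmult, measurable, subst nn_integral_PiM_gauss_exp_sum_squared) (auto simp: mult.assoc)
    finally show ?thesis by (simp add: mult.assoc flip: ennreal_mult' exp_add)
  qed
  have prod: "exp (n * c + u * sqnorm n (\<lambda>j. \<Sum>i\<in>S. s * w j i) - k * (\<Sum>i\<in>S. sqnorm n (\<lambda>j. s * w j i)))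
     = (\<Prod>j<n. f (w j))" for w
  proof -
    have "sqnorm n (\<lambda>j. \<Sum>i\<in>S. s * w j i) = (\<Sum>j<n. V * (\<Sum>i\<in>S. w j i)\<^sup>2)"
      unfolding sqnorm_def assms(1)[symmetric] by (simp add: power_mult_distrib flip: sum_distrib_left)
    moreover have "(\<Sum>i\<in>S. sqnorm n (\<lambda>j. s * w j i)) = (\<Sum>j<n. V * (\<Sum>i\<in>S. (w j i)\<^sup>2))"
      unfolding sqnorm_def assms(1)[symmetric] by (subst sum.swap) (simp add: power_mult_distrib sum_distrib_left)
    ultimately show ?thesis
      unfolding f_def exp_sum[OF finite_lessThan, symmetric]
      by (simp add: sum.distrib sum_subtractf sum_distrib_left mult.assoc)
  qed
  show ?thesis
    unfolding prod
    using nn_integral_PiM_prod_const[OF G.prob_space_axioms, of "{..<n}" "\<lambda>v. ennreal (f v)"]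
    by (simp add: prod_ennreal f_def[abs_def] one[unfolded f_def] ennreal_power flip: exp_of_nat_mult)
qed

section \<open>First-moment selection and deletion of bad indices\<close>

lemma (in prob_space) exists_less_of_nn_integral_less:
  assumes "(\<integral>\<^sup>+w. ennreal (f w) \<partial>M) < ennreal c"
  shows "\<exists>w. f w < c"
proof (rule ccontr)
  assume "\<not> ?thesis"
  then have "(\<integral>\<^sup>+w. ennreal c \<partial>M) \<le> (\<integral>\<^sup>+w. ennreal (f w) \<partial>M)"
    by (intro nn_integral_mono ennreal_leI) (auto simp: not_less)
  then show False using assms by (simp add: emeasure_space_1)
qed

lemma card_le_sum_of_ge_1:
  fixes f :: "'a \<Rightarrow> real"
  assumes "finite A" "\<And>a. a \<in> A \<Longrightarrow> f a \<ge> 0" "\<And>a. a \<in> A \<Longrightarrow> Q a \<Longrightarrow> f a \<ge> 1"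
  shows "card {a \<in> A. Q a} \<le> (\<Sum>a\<in>A. f a)"
proof -
  have "card {a \<in> A. Q a} \<le> (\<Sum>a\<in>{a \<in> A. Q a}. f a)"
    using sum_bounded_below[of "{a \<in> A. Q a}" 1 f] assms by auto
  also have "\<dots> \<le> (\<Sum>a\<in>A. f a)" using assms by (intro sum_mono2) auto
  finally show ?thesis .
qed

text \<open>First-moment method: each bad event is charged an exponential weight that is at least 1
  on it, and the expected total weight is the left side of the smallness hypothesis. The parameter
  \<open>t\<close> handles norms that are too large or too small; \<open>u\<close> and
  \<open>k\<close> jointly handle \<open>L\<close>-sets whose sum is long although their norms are
  not large.\<close>

lemma exists_gauss_family_few_bad:
  fixes V N \<delta> t u k :: real and n m L :: nat
  assumes "V > 0" "t \<ge> 0" "2 * t * V < 1" "u \<ge> 0" "k \<ge> 0" "2 * L * u * V < 1 + 2 * k * V"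
  assumes small: "m * (exp (n * (- (t * (V + \<delta>)) - ln (1 - 2 * t * V) / 2))
        + exp (n * (t * (V - \<delta>) - ln (1 + 2 * t * V) / 2)))
      + (m choose L) * exp (n * (k * L * (V + \<delta>) - u * L\<^sup>2 * (V - \<delta> - N) - L / 2 * ln (1 + 2 * k * V)
          - ln (1 - 2 * L * u * V / (1 + 2 * k * V)) / 2)) < m / 2"
  shows "\<exists>x. (\<forall>i. in_Rn n (x i)) \<and>
    card {i. i < m \<and> \<not> (n * (V - \<delta>) \<le> sqnorm n (x i) \<and> sqnorm n (x i) \<le> n * (V + \<delta>))}
    + card {S. S \<subseteq> {..<m} \<and> card S = L \<and> n * L\<^sup>2 * (V - \<delta> - N) \<le> sqnorm n (\<lambda>j. \<Sum>i\<in>S. x i j)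
        \<and> (\<Sum>i\<in>S. sqnorm n (x i)) \<le> n * L * (V + \<delta>)} < m / 2"
proof -
  let ?G = "PiM {..<m} (\<lambda>_. gauss)"
  let ?M = "PiM {..<n} (\<lambda>_. ?G)"
  interpret M: prob_space ?M by (intro prob_space_PiM prob_space_gauss)
  define s where "s = sqrt V"
  have s: "s\<^sup>2 = V" using assms by (simp add: s_def)
  define a1 where "a1 = - (t * (V + \<delta>)) - ln (1 - 2 * t * V) / 2"
  define a2 where "a2 = t * (V - \<delta>) - ln (1 + 2 * t * V) / 2"
  define b where "b = k * L * (V + \<delta>) - u * L\<^sup>2 * (V - \<delta> - N) - L / 2 * ln (1 + 2 * k * V)
          - ln (1 - 2 * L * u * V / (1 + 2 * k * V)) / 2"
  define y where "y w i j = s * w j i" for w :: "nat \<Rightarrow> nat \<Rightarrow> real" and i j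
  \<comment> \<open>One Chernoff weight serves all events: a singleton with \<open>u = 0\<close> and
    \<open>k = - t\<close> or \<open>k = t\<close> for the two norm tails, an \<open>L\<close>-set
    with the given \<open>u\<close> and \<open>k\<close> for long sums.\<close>
  define W where "W c u k S w = exp (n * c + u * sqnorm n (\<lambda>j. \<Sum>i\<in>S. y w i j) - k * (\<Sum>i\<in>S. sqnorm n (y w i)))"
    for c u k :: real and S w
  define \<S> where "\<S> = {S. S \<subseteq> {..<m} \<and> card S = L}"
  have fin: "finite \<S>" unfolding \<S>_def by (rule finite_subset[of _ "Pow {..<m}"]) auto
  have card\<S>: "card \<S> = m choose L" unfolding \<S>_def by (subst n_subsets) auto
  have comp: "(\<lambda>w. w j i) \<in> borel_measurable ?M" if "i < m" "j < n" for i j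
  proof -
    have "(\<lambda>w. w j) \<in> measurable ?M ?G" using that by (intro measurable_component_singleton) auto
    moreover have "(\<lambda>v. v i) \<in> measurable ?G gauss" using that by (intro measurable_component_singleton) auto
    ultimately have "(\<lambda>w. w j i) \<in> measurable ?M gauss" by (rule measurable_compose)
    then show ?thesis by (simp add: measurable_cong_sets[OF refl sets_gauss])
  qed
  have meas: "W c u k S \<in> borel_measurable ?M" if "S \<subseteq> {..<m}" for c u k S
    unfolding W_def y_def sqnorm_def using that
    by (auto intro!: measurable_compose[OF _ borel_measurable_exp] borel_measurable_sum borel_measurable_times
        borel_measurable_power borel_measurable_diff borel_measurable_add comp)
  have int: "(\<integral>\<^sup>+w. ennreal (W c u k S w) \<partial>?M)
     = ennreal (exp (n * (c - card S / 2 * ln (1 + 2 * k * V) - ln (1 - 2 * card S * u * V / (1 + 2 * k * V)) / 2)))"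
    if "S \<subseteq> {..<m}" "u \<ge> 0" "1 + 2 * k * V > 0" "2 * card S * u * V < 1 + 2 * k * V" for c u k :: real and S
    unfolding W_def y_def using that by (rule nn_integral_gauss_matrix_exp[OF s])
  have kV: "1 + 2 * k * V > 0" "1 + 2 * t * V > 0" using assms by (auto intro!: add_pos_nonneg)
  have int1: "(\<integral>\<^sup>+w. ennreal (W (- (t * (V + \<delta>))) 0 (- t) {i} w) \<partial>?M) = ennreal (exp (n * a1))" if "i < m" for i
    using int[of "{i}" 0 "- t"] that assms by (simp add: a1_def)
  have int2: "(\<integral>\<^sup>+w. ennreal (W (t * (V - \<delta>)) 0 t {i} w) \<partial>?M) = ennreal (exp (n * a2))" if "i < m" for i
    using int[of "{i}" 0 t] that kV by (simp add: a2_def)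
  have int3: "(\<integral>\<^sup>+w. ennreal (W (k * L * (V + \<delta>) - u * L\<^sup>2 * (V - \<delta> - N)) u k S w) \<partial>?M) = ennreal (exp (n * b))"
    if "S \<in> \<S>" for S
    using int[of S u k] that assms kV by (simp add: b_def \<S>_def)
  have mE: "(\<lambda>w. ennreal (W c u k S w)) \<in> borel_measurable ?M" if "S \<subseteq> {..<m}" for c u k S
    using meas[OF that] by (rule measurable_compose) simp
  have i1: "(\<integral>\<^sup>+w. (\<Sum>i<m. ennreal (W (- (t * (V + \<delta>))) 0 (- t) {i} w) + ennreal (W (t * (V - \<delta>)) 0 t {i} w)) \<partial>?M)
    = (\<Sum>i<m. (\<integral>\<^sup>+w. ennreal (W (- (t * (V + \<delta>))) 0 (- t) {i} w) \<partial>?M)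
        + (\<integral>\<^sup>+w. ennreal (W (t * (V - \<delta>)) 0 t {i} w) \<partial>?M))"
    using mE by (subst nn_integral_sum) (auto intro!: borel_measurable_add sum.cong nn_integral_add simp del: ennreal_plus)
  have i2: "(\<integral>\<^sup>+w. (\<Sum>S\<in>\<S>. ennreal (W (k * L * (V + \<delta>) - u * L\<^sup>2 * (V - \<delta> - N)) u k S w)) \<partial>?M)
    = (\<Sum>S\<in>\<S>. (\<integral>\<^sup>+w. ennreal (W (k * L * (V + \<delta>) - u * L\<^sup>2 * (V - \<delta> - N)) u k S w) \<partial>?M))"
    using mE by (intro nn_integral_sum) (auto simp: \<S>_def)
  define T where "T w = (\<Sum>i<m. W (- (t * (V + \<delta>))) 0 (- t) {i} w + W (t * (V - \<delta>)) 0 t {i} w)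
     + (\<Sum>S\<in>\<S>. W (k * L * (V + \<delta>) - u * L\<^sup>2 * (V - \<delta> - N)) u k S w)" for w
  have W0: "W c u k S w \<ge> 0" for c u k S w by (simp add: W_def)
  have "(\<integral>\<^sup>+w. ennreal (T w) \<partial>?M)
    = (\<integral>\<^sup>+w. (\<Sum>i<m. ennreal (W (- (t * (V + \<delta>))) 0 (- t) {i} w) + ennreal (W (t * (V - \<delta>)) 0 t {i} w))
      + (\<Sum>S\<in>\<S>. ennreal (W (k * L * (V + \<delta>) - u * L\<^sup>2 * (V - \<delta> - N)) u k S w)) \<partial>?M)"
    by (simp add: T_def W0 sum_nonneg flip: ennreal_plus)
  also have "\<dots> = (\<Sum>i<m. (\<integral>\<^sup>+w. ennreal (W (- (t * (V + \<delta>))) 0 (- t) {i} w) \<partial>?M)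
        + (\<integral>\<^sup>+w. ennreal (W (t * (V - \<delta>)) 0 t {i} w) \<partial>?M))
      + (\<Sum>S\<in>\<S>. (\<integral>\<^sup>+w. ennreal (W (k * L * (V + \<delta>) - u * L\<^sup>2 * (V - \<delta> - N)) u k S w) \<partial>?M))"
    unfolding i1[symmetric] i2[symmetric] using mE
    by (intro nn_integral_add) (auto simp: \<S>_def simp del: sum_ennreal intro!: borel_measurable_sum borel_measurable_add)
  also have "\<dots> = (\<Sum>i<m. ennreal (exp (n * a1)) + ennreal (exp (n * a2))) + (\<Sum>S\<in>\<S>. ennreal (exp (n * b)))"
    using int1 int2 int3 by simp
  also have "\<dots> = ennreal (m * (exp (n * a1) + exp (n * a2)) + (m choose L) * exp (n * b))"
    by (simp add: card\<S> ennreal_mult' ennreal_of_nat_eq_real_of_nat)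
  also have "\<dots> < ennreal (m / 2)"
  proof (rule ennreal_lessI)
    show *: "m * (exp (n * a1) + exp (n * a2)) + (m choose L) * exp (n * b) < m / 2"
      using small unfolding a1_def a2_def b_def .
    have "0 \<le> m * (exp (n * a1) + exp (n * a2)) + (m choose L) * exp (n * b)"
      by (intro add_nonneg_nonneg mult_nonneg_nonneg) auto
    then show "0 < m / 2" using * by linarith
  qed
  finally obtain w where w: "T w < m / 2"
    using M.exists_less_of_nn_integral_less by blast
  \<comment> \<open>Entries from index \<open>n\<close> on are set to 0 to land in
    \<open>R^n\<close>; norms and sums see only the first \<open>n\<close> entries.\<close>
  define x where "x i j = (if j < n then y w i j else 0)" for i j
  have x: "sqnorm n (x i) = sqnorm n (y w i)" "sqnorm n (\<lambda>j. \<Sum>i\<in>S. x i j) = sqnorm n (\<lambda>j. \<Sum>i\<in>S. y w i j)" for i S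
    by (auto simp: sqnorm_def x_def)
  let ?f = "\<lambda>i. W (- (t * (V + \<delta>))) 0 (- t) {i} w + W (t * (V - \<delta>)) 0 t {i} w"
  have "card {i \<in> {..<m}. \<not> (n * (V - \<delta>) \<le> sqnorm n (x i) \<and> sqnorm n (x i) \<le> n * (V + \<delta>))} \<le> (\<Sum>i<m. ?f i)"
  proof (rule card_le_sum_of_ge_1)
    fix i assume "\<not> (n * (V - \<delta>) \<le> sqnorm n (x i) \<and> sqnorm n (x i) \<le> n * (V + \<delta>))"
    then consider "sqnorm n (y w i) \<le> n * (V - \<delta>)" | "sqnorm n (y w i) \<ge> n * (V + \<delta>)" by (auto simp: x)
    then show "?f i \<ge> 1"
    proof cases
      case 1
      from mult_left_mono[OF this \<open>t \<ge> 0\<close>] have "W (t * (V - \<delta>)) 0 t {i} w \<ge> 1" by (simp add: W_def mult_ac)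
      then show ?thesis using W0 by (simp add: add_increasing)
    next
      case 2
      from mult_left_mono[OF this \<open>t \<ge> 0\<close>] have "W (- (t * (V + \<delta>))) 0 (- t) {i} w \<ge> 1" by (simp add: W_def mult_ac)
      then show ?thesis using W0 by (simp add: add_increasing2)
    qed
  qed (auto simp: W0)
  moreover have "card {S \<in> \<S>. n * L\<^sup>2 * (V - \<delta> - N) \<le> sqnorm n (\<lambda>j. \<Sum>i\<in>S. x i j)
        \<and> (\<Sum>i\<in>S. sqnorm n (x i)) \<le> n * L * (V + \<delta>)}
      \<le> (\<Sum>S\<in>\<S>. W (k * L * (V + \<delta>) - u * L\<^sup>2 * (V - \<delta> - N)) u k S w)"
  proof (rule card_le_sum_of_ge_1[OF fin])
    fix S assume S: "n * L\<^sup>2 * (V - \<delta> - N) \<le> sqnorm n (\<lambda>j. \<Sum>i\<in>S. x i j)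
        \<and> (\<Sum>i\<in>S. sqnorm n (x i)) \<le> n * L * (V + \<delta>)"
    have "u * (n * L\<^sup>2 * (V - \<delta> - N)) \<le> u * sqnorm n (\<lambda>j. \<Sum>i\<in>S. y w i j)"
      using S assms by (intro mult_left_mono) (auto simp: x)
    moreover have "k * (\<Sum>i\<in>S. sqnorm n (y w i)) \<le> k * (n * L * (V + \<delta>))"
      using S assms by (intro mult_left_mono) (auto simp: x)
    ultimately show "W (k * L * (V + \<delta>) - u * L\<^sup>2 * (V - \<delta> - N)) u k S w \<ge> 1"
      by (simp add: W_def algebra_simps)
  qed (auto simp: W0)
  ultimately have "card {i \<in> {..<m}. \<not> (n * (V - \<delta>) \<le> sqnorm n (x i) \<and> sqnorm n (x i) \<le> n * (V + \<delta>))}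
    + card {S \<in> \<S>. n * L\<^sup>2 * (V - \<delta> - N) \<le> sqnorm n (\<lambda>j. \<Sum>i\<in>S. x i j)
        \<and> (\<Sum>i\<in>S. sqnorm n (x i)) \<le> n * L * (V + \<delta>)} < m / 2"
    using w unfolding T_def by linarith
  then show ?thesis
    by (intro exI[of _ x]) (simp add: \<S>_def conj_assoc in_Rn_def x_def)
qed

text \<open>Repeated points are harmless: \<open>L\<close> equal points in the shell would form a bad index set, so
  every point occurs fewer than \<open>L\<close> times.\<close>

lemma code_of_few_bad:
  fixes V N \<delta> :: real and n m L :: nat and x :: "nat \<Rightarrow> nat \<Rightarrow> real"
  assumes "L > 0" "N \<ge> 0"
  assumes Rn: "\<And>i. in_Rn n (x i)"
  assumes few: "card {i. i < m \<and> \<not> (n * (V - \<delta>) \<le> sqnorm n (x i) \<and> sqnorm n (x i) \<le> n * (V + \<delta>))}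
    + card {S. S \<subseteq> {..<m} \<and> card S = L \<and> n * L\<^sup>2 * (V - \<delta> - N) \<le> sqnorm n (\<lambda>j. \<Sum>i\<in>S. x i j)
        \<and> (\<Sum>i\<in>S. sqnorm n (x i)) \<le> n * L * (V + \<delta>)} < m / 2"
  shows "\<exists>C. avg_rad_LD_code n (V + \<delta>) N L C \<and> m \<le> 2 * L * card C"
proof -
  define B1 where "B1 = {i. i < m \<and> \<not> (n * (V - \<delta>) \<le> sqnorm n (x i) \<and> sqnorm n (x i) \<le> n * (V + \<delta>))}"
  define B2 where "B2 = {S. S \<subseteq> {..<m} \<and> card S = L \<and> n * L\<^sup>2 * (V - \<delta> - N) \<le> sqnorm n (\<lambda>j. \<Sum>i\<in>S. x i j)
        \<and> (\<Sum>i\<in>S. sqnorm n (x i)) \<le> n * L * (V + \<delta>)}"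
  have fin: "finite B1" "finite B2"
    unfolding B1_def B2_def by (auto intro: finite_subset[of _ "Pow {..<m}"])
  \<comment> \<open>One index is deleted from every bad set, so no \<open>L\<close>-subset of the
    surviving indices is bad.\<close>
  define pick where "pick S = (SOME i. i \<in> S)" for S :: "nat set"
  have pick: "pick S \<in> S" if "S \<in> B2" for S
  proof -
    have "S \<noteq> {}" using that \<open>L > 0\<close> by (auto simp: B2_def)
    then show ?thesis unfolding pick_def by (simp add: some_in_eq)
  qed
  define J where "J = {..<m} - (B1 \<union> pick ` B2)"
  have fJ: "finite J" by (simp add: J_def)
  have "m - card (B1 \<union> pick ` B2) \<le> card J"
    unfolding J_def using diff_card_le_card_Diff[of "B1 \<union> pick ` B2" "{..<m}"] fin by simp
  moreover have "card (B1 \<union> pick ` B2) \<le> card B1 + card B2"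
    using card_Un_le[of B1 "pick ` B2"] card_image_le[OF fin(2), of pick] by linarith
  ultimately have cJ: "m \<le> 2 * card J"
    using few unfolding B1_def[symmetric] B2_def[symmetric] by linarith
  have norm: "n * (V - \<delta>) \<le> sqnorm n (x i)" "sqnorm n (x i) \<le> n * (V + \<delta>)" if "i \<in> J" for i
    using that by (auto simp: J_def B1_def)
  have good: "sqnorm n (\<lambda>j. \<Sum>i\<in>S. x i j) < n * L\<^sup>2 * (V - \<delta> - N)" if "S \<subseteq> J" "card S = L" for S
  proof (rule ccontr)
    assume "\<not> ?thesis"
    moreover have "(\<Sum>i\<in>S. sqnorm n (x i)) \<le> n * L * (V + \<delta>)"
      using sum_bounded_above[of S "\<lambda>i. sqnorm n (x i)" "n * (V + \<delta>)"] norm that by (auto simp: mult_ac)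
    ultimately have "S \<in> B2" using that by (auto simp: B2_def J_def)
    then show False using pick[of S] that by (auto simp: J_def)
  qed
  have fibre: "card {i \<in> J. x i = p} \<le> L" for p
  proof (rule ccontr)
    assume "\<not> ?thesis"
    then have "L \<le> card {i \<in> J. x i = p}" by simp
    then obtain S where S: "S \<subseteq> {i \<in> J. x i = p}" "card S = L"
      by (rule obtain_subset_with_card_n)
    have "S \<noteq> {}" using S \<open>L > 0\<close> by auto
    then obtain i where i: "i \<in> J" "x i = p" using S by auto
    have "(\<lambda>j. \<Sum>i\<in>S. x i j) = (\<lambda>j. L * p j)"
      using S by (auto simp: fun_eq_iff subset_iff)
    then have "sqnorm n (\<lambda>j. \<Sum>i\<in>S. x i j) = L\<^sup>2 * sqnorm n p"
      by (simp add: sqnorm_def power_mult_distrib sum_distrib_left)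
    moreover have "L\<^sup>2 * (n * (V - \<delta>)) \<le> L\<^sup>2 * sqnorm n p"
      using norm[OF i(1)] i(2) by (intro mult_left_mono) auto
    moreover have "n * L\<^sup>2 * (V - \<delta> - N) \<le> n * L\<^sup>2 * (V - \<delta>)"
      using \<open>N \<ge> 0\<close> by (intro mult_left_mono) auto
    moreover have "sqnorm n (\<lambda>j. \<Sum>i\<in>S. x i j) < n * L\<^sup>2 * (V - \<delta> - N)"
      using S by (intro good) auto
    ultimately show False by (simp add: mult_ac)
  qed
  define C where "C = x ` J"
  have "card J = (\<Sum>p\<in>C. card {i \<in> J. x i = p})"
    unfolding C_def card_eq_sum using sum.image_gen[OF fJ, of "\<lambda>_. 1::nat" x] by simp
  also have "\<dots> \<le> card C * L"
    using sum_bounded_above[of C "\<lambda>p. card {i \<in> J. x i = p}" L] fibre by simp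
  finally have card: "m \<le> 2 * L * card C" using cJ by (simp add: mult_ac)
  have "avg_sq_rad n S > n * N" if "S \<subseteq> C" "card S = L" for S
  proof -
    \<comment> \<open>A set of distinct codewords is lifted to an index set on which
      \<open>x\<close> is injective, so that the estimate for \<open>L\<close>-sets of indices
      applies.\<close>
    obtain U where U: "U \<subseteq> J" "inj_on x U" "S = x ` U"
      using \<open>S \<subseteq> C\<close> unfolding C_def subset_image_inj by blast
    have cU: "card U = L" using U that by (simp add: card_image)
    have S: "finite S" "S \<noteq> {}" using that \<open>L > 0\<close> by (auto intro: card_ge_0_finite)
    \<comment> \<open>In this form, norms of at least \<open>n * (V - \<delta>)\<close> and a sum
      shorter than the threshold leave more than \<open>L * (L * (n * N))\<close>.\<close>
    have "L * (L * avg_sq_rad n S) = L * (\<Sum>i\<in>U. sqnorm n (x i)) - sqnorm n (\<lambda>j. \<Sum>i\<in>U. x i j)"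
      using card_times_avg_sq_rad[OF S, of n] that U \<open>L > 0\<close> by (simp add: sum.reindex right_diff_distrib)
    moreover have "L * (\<Sum>i\<in>U. sqnorm n (x i)) \<ge> L * (L * (n * (V - \<delta>)))"
      using sum_bounded_below[of U "n * (V - \<delta>)" "\<lambda>i. sqnorm n (x i)"] norm U cU
      by (intro mult_left_mono) auto
    moreover have "sqnorm n (\<lambda>j. \<Sum>i\<in>U. x i j) < n * L\<^sup>2 * (V - \<delta> - N)"
      using U cU by (intro good) auto
    ultimately have "L * (L * avg_sq_rad n S) > L * (L * (n * N))"
      by (simp add: power2_eq_square algebra_simps)
    then show ?thesis using \<open>L > 0\<close> by simp
  qed
  moreover have "C \<subseteq> ball_nP n (V + \<delta>)"
    using norm Rn by (auto simp: C_def ball_nP_def)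
  ultimately have "avg_rad_LD_code n (V + \<delta>) N L C"
    using fJ by (simp add: avg_rad_LD_code_def C_def)
  with card show ?thesis by blast
qed

section \<open>Rates achieved by random codes\<close>

text \<open>About \<open>exp (n * R)\<close> codewords are drawn. For small \<open>t\<close> a
  codeword is atypical with exponentially small probability, and the expected number of bad
  \<open>L\<close>-sets per codeword is at most of order \<open>exp (n * ((L - 1) * R + b))\<close>,
  where \<open>b\<close> is the bracketed exponent. A fraction of at least
  \<open>1 / (2 * L)\<close> survives, a loss that disappears in the rate.\<close>

lemma avg_rad_LD_capacity_ge:
  fixes V N \<delta> u k R :: real and L :: nat
  assumes "V > 0" "N \<ge> 0" "\<delta> > 0" "L > 0" "R \<ge> 0" "u \<ge> 0" "k \<ge> 0" "2 * L * u * V < 1 + 2 * k * V"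
  assumes R: "(real L - 1) * R + (k * L * (V + \<delta>) - u * L\<^sup>2 * (V - \<delta> - N) - L / 2 * ln (1 + 2 * k * V)
          - ln (1 - 2 * L * u * V / (1 + 2 * k * V)) / 2) < 0"
  shows "avg_rad_LD_capacity (V + \<delta>) N L \<ge> ereal R"
proof -
  define b where "b = k * L * (V + \<delta>) - u * L\<^sup>2 * (V - \<delta> - N) - L / 2 * ln (1 + 2 * k * V)
          - ln (1 - 2 * L * u * V / (1 + 2 * k * V)) / 2"
  \<comment> \<open>Exponents of the two tail bounds for the norm of one codeword. Both vanish at 0
    with slope \<open>- \<delta>\<close>, so a small positive \<open>t\<close> makes both
    negative.\<close>
  define F1 where "F1 t = - (t * (V + \<delta>)) - ln (1 - 2 * t * V) / 2" for t
  define F2 where "F2 t = t * (V - \<delta>) - ln (1 + 2 * t * V) / 2" for t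
  have F1': "(F1 has_real_derivative - \<delta>) (at 0)"
    unfolding F1_def by (auto intro!: derivative_eq_intros)
  have F2': "(F2 has_real_derivative - \<delta>) (at 0)"
    unfolding F2_def by (auto intro!: derivative_eq_intros)
  obtain d1 where d1: "d1 > 0" "\<And>t. 0 < t \<Longrightarrow> t < d1 \<Longrightarrow> F1 t < F1 0"
    using DERIV_neg_dec_right[OF F1'] assms by auto
  obtain d2 where d2: "d2 > 0" "\<And>t. 0 < t \<Longrightarrow> t < d2 \<Longrightarrow> F2 t < F2 0"
    using DERIV_neg_dec_right[OF F2'] assms by auto
  \<comment> \<open>This cap on \<open>t\<close> keeps \<open>1 - 2 * t * V\<close>
    positive.\<close>
  define e where "e = 1 / (2 * V)"
  have half: "e > 0" using \<open>V > 0\<close> by (simp add: e_def)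
  define t where "t = min (min d1 d2) e / 2"
  have t: "0 < t" "t < d1" "t < d2" "t < e" using d1 d2 half by (auto simp: t_def min_def)
  then have tV: "2 * t * V < 1" using \<open>V > 0\<close> by (simp add: e_def field_simps)
  have a: "F1 t < 0" "F2 t < 0"
    using d1(2)[of t] d2(2)[of t] t by (auto simp: F1_def F2_def)
  define r where "r = (real L - 1) * R + b"
  have r: "r < 0" using R by (simp add: r_def b_def)
  have lim: "((\<lambda>n. exp (real n * a)) \<longlongrightarrow> 0) sequentially" if "a < 0" for a
    using that by real_asymp
  have "((\<lambda>n. exp (real n * F1 t) + exp (real n * F2 t) + 2 ^ (L - 1) * exp (real n * r)) \<longlongrightarrow> 0) sequentially"
    by (rule tendsto_eq_intros lim a r refl | simp)+
  then have ev: "\<forall>\<^sub>F n in sequentially. exp (real n * F1 t) + exp (real n * F2 t) + 2 ^ (L - 1) * exp (real n * r) < 1 / 2"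
    by (intro order_tendstoD) auto
  have exists_code: "\<exists>C. avg_rad_LD_code n (V + \<delta>) N L C \<and> R - ln (2 * L) / n \<le> rate n C"
    if n: "exp (real n * F1 t) + exp (real n * F2 t) + 2 ^ (L - 1) * exp (real n * r) < 1 / 2" "n > 0" for n
  proof -
    define m where "m = nat \<lceil>exp (n * R)\<rceil>"
    have m: "exp (n * R) \<le> m" "m \<le> exp (n * R) + 1"
      using of_int_ceiling_le_add_one[of "exp (n * R)"] order_less_le_trans[OF exp_gt_zero le_of_int_ceiling, of "n * R"]
      by (auto simp: m_def)
    \<comment> \<open>Since \<open>R \<ge> 0\<close>, rounding up costs at most a factor 2; this is
      the source of \<open>2 ^ (L - 1)\<close>.\<close>
    have "exp (n * R) \<ge> 1" using \<open>R \<ge> 0\<close> by simp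
    then have m': "m > 0" "m \<le> 2 * exp (n * R)" using m by linarith+
    have "real (m choose L) \<le> m ^ L"
      using binomial_le_pow[of L m] by (cases "L \<le> m") (auto simp: binomial_eq_0 simp flip: of_nat_power)
    also have "\<dots> = m * real m ^ (L - 1)" using \<open>L > 0\<close> by (cases L) auto
    also have "\<dots> \<le> m * (2 * exp (n * R)) ^ (L - 1)"
      using m' by (intro mult_left_mono power_mono) auto
    also have "\<dots> = m * (2 ^ (L - 1) * exp (n * ((real L - 1) * R)))"
      using \<open>L > 0\<close> by (simp add: power_mult_distrib of_nat_diff mult_ac flip: exp_of_nat_mult)
    finally have "(m choose L) * exp (n * b) \<le> m * (2 ^ (L - 1) * exp (n * ((real L - 1) * R))) * exp (n * b)"
      by (intro mult_right_mono) auto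
    also have "\<dots> = m * (2 ^ (L - 1) * exp (n * r))"
      by (simp add: r_def distrib_left exp_add)
    finally have "m * (exp (n * F1 t) + exp (n * F2 t)) + (m choose L) * exp (n * b)
      \<le> m * (exp (n * F1 t) + exp (n * F2 t) + 2 ^ (L - 1) * exp (n * r))"
      by (simp add: distrib_left)
    also have "\<dots> < m * (1 / 2)" using n m' by (intro mult_strict_left_mono) auto
    finally have "m * (exp (n * F1 t) + exp (n * F2 t)) + (m choose L) * exp (n * b) < m / 2" by simp
    from exists_gauss_family_few_bad[OF \<open>V > 0\<close> _ tV \<open>u \<ge> 0\<close> \<open>k \<ge> 0\<close> assms(8) this[unfolded F1_def F2_def b_def]] t
    obtain C where C: "avg_rad_LD_code n (V + \<delta>) N L C" "m \<le> 2 * L * card C"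
      using code_of_few_bad[OF \<open>L > 0\<close> \<open>N \<ge> 0\<close>, of n _ m V \<delta>] by auto
    have pos: "card C > 0" using C m' by (cases "card C = 0") auto
    have "exp (n * R) \<le> 2 * L * card C"
      using m(1) of_nat_mono[OF C(2), where ?'a = real] by linarith
    then have "n * R \<le> ln (2 * L * card C)" by (subst ln_ge_iff) (use \<open>L > 0\<close> pos in auto)
    also have "\<dots> = ln (2 * L) + ln (card C)" using \<open>L > 0\<close> pos by (simp add: ln_mult)
    finally have "R \<le> (ln (2 * L) + ln (card C)) / n" using n(2) by (simp add: pos_le_divide_eq mult.commute)
    then have "R - ln (2 * L) / n \<le> rate n C" by (simp add: rate_def add_divide_distrib)
    with C show ?thesis by blast
  qed
  have "((\<lambda>n. R - ln (2 * L) / real n) \<longlongrightarrow> R - 0) sequentially"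
    by (intro tendsto_intros)
  then have "liminf (\<lambda>n. ereal (R - ln (2 * L) / real n)) = ereal R"
    by (intro lim_imp_Liminf) auto
  then have "ereal R = liminf (\<lambda>n. ereal (R - ln (2 * L) / real n))" by simp
  also have "\<dots> \<le> liminf (\<lambda>n. SUP C\<in>{C. avg_rad_LD_code n (V + \<delta>) N L C}. ereal (rate n C))"
  proof (rule Liminf_mono)
    show "\<forall>\<^sub>F n in sequentially. ereal (R - ln (2 * L) / real n) \<le> (SUP C\<in>{C. avg_rad_LD_code n (V + \<delta>) N L C}. ereal (rate n C))"
      using ev eventually_gt_at_top[of 0]
    proof eventually_elim
      case (elim n)
      then obtain C where "avg_rad_LD_code n (V + \<delta>) N L C" "R - ln (2 * L) / n \<le> rate n C"
        using exists_code by blast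
      then show ?case by (intro SUP_upper2[of C]) auto
    qed
  qed
  also have "\<dots> \<le> avg_rad_LD_capacity (V + \<delta>) N L"
    unfolding avg_rad_LD_capacity_def by (rule Liminf_le_Limsup) simp
  finally show ?thesis .
qed

text \<open>Instance \<open>\<delta> = 1 / L\<close>, \<open>1 + 2 k V = V / N\<close> and \<open>2 L u V = V / N - 1 / L\<close> of the preceding lemma.\<close>

lemma avg_rad_LD_capacity_ge_explicit:
  fixes P N R :: real and L :: nat
  defines "V \<equiv> P - 1 / L"
  assumes "N > 0" "N < V" "L > 1" "R \<ge> 0"
    and R: "R < ln (V / N) / 2 - ln L / (2 * (real L - 1)) - (2 * V / N - 1 - 1 / L + V - N) / (2 * V * (real L - 1))"
  shows "avg_rad_LD_capacity P N L \<ge> ereal R"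
proof -
  define \<delta> where "\<delta> = 1 / real L"
  have \<delta>: "\<delta> > 0" "\<delta> < 1" using \<open>L > 1\<close> by (auto simp: \<delta>_def)
  have L\<delta>: "L * \<delta> = 1" using \<open>L > 1\<close> by (simp add: \<delta>_def)
  have V: "V > 0" "V / N > 1" using assms by auto
  \<comment> \<open>With \<open>y = 1 + 2 * k * V\<close> and \<open>2 * L * u * V\<close> close to
    \<open>y\<close>, the exponent is to leading order
    \<open>L / 2 * (y * N / V - 1 - ln y)\<close>, minimal at \<open>y = V / N\<close> with value
    \<open>- L / 2 * ln (V / N)\<close>. The gap \<open>\<delta>\<close> left between
    \<open>2 * L * u * V\<close> and \<open>y\<close> keeps the last logarithm finite, at the cost
    of a term \<open>ln L / 2\<close>.\<close>
  define k where "k = (V / N - 1) / (2 * V)"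
  define u where "u = (V / N - \<delta>) / (2 * L * V)"
  have "k \<ge> 0" "u \<ge> 0"
    unfolding k_def u_def using V \<delta> by (auto intro!: divide_nonneg_nonneg)
  moreover have "1 + 2 * k * V = V / N" "2 * L * u * V = V / N - \<delta>"
    using V \<open>N > 0\<close> \<open>L > 1\<close> by (simp_all add: k_def u_def field_simps)
  ultimately have k: "k \<ge> 0" "1 + 2 * k * V = V / N" and u: "u \<ge> 0" "2 * L * u * V = V / N - \<delta>" by auto
  have "1 - 2 * L * u * V / (1 + 2 * k * V) = \<delta> * N / V"
    unfolding k(2) u(2) using V \<open>N > 0\<close> by (simp add: field_simps)
  then have ln: "ln (1 - 2 * L * u * V / (1 + 2 * k * V)) = - ln L - ln (V / N)"
    using V \<open>N > 0\<close> \<open>L > 1\<close> by (simp add: \<delta>_def ln_mult ln_div)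
  have distrib: "c * a * w - c * b * z = c * (a * w - b * z)" for a b c w z :: real
    by (simp add: algebra_simps)
  have uk: "u * L\<^sup>2 = L / (2 * V) * (V / N - \<delta>)" "k * L = L / (2 * V) * (V / N - 1)"
    using \<open>L > 1\<close> by (simp_all add: u_def k_def power2_eq_square)
  have "k * L * (V + \<delta>) - u * L\<^sup>2 * (V - \<delta> - N) = L / (2 * V) * ((V / N - 1) * (V + \<delta>) - (V / N - \<delta>) * (V - \<delta> - N))"
    unfolding uk by (rule distrib)
  also have "(V / N - 1) * (V + \<delta>) - (V / N - \<delta>) * (V - \<delta> - N) = \<delta> * (2 * V / N - 1 - \<delta> + V - N)"
    using \<open>N > 0\<close> by (simp add: field_simps)
  also have "L / (2 * V) * \<dots> = (L * \<delta>) * (2 * V / N - 1 - \<delta> + V - N) / (2 * V)" by simp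
  finally have lin: "k * L * (V + \<delta>) - u * L\<^sup>2 * (V - \<delta> - N) = (2 * V / N - 1 - 1 / L + V - N) / (2 * V)"
    unfolding L\<delta> by (simp add: \<delta>_def)
  \<comment> \<open>For fixed \<open>P\<close> and \<open>N\<close> this error stays bounded as
    \<open>L\<close> grows, so it disappears after division by \<open>L - 1\<close>.\<close>
  define E where "E = (2 * V / N - 1 - 1 / L + V - N) / (2 * V)"
  have scale: "l * (x / 2 - y / (2 * l) - E / l) = l * x / 2 - y / 2 - E" if "l > 0" for l x y :: real
    using that by (simp add: field_simps)
  have L1: "real L - 1 > 0" using \<open>L > 1\<close> by simp
  have "(real L - 1) * R < (real L - 1) * (ln (V / N) / 2 - ln L / (2 * (real L - 1)) - E / (real L - 1))"
    using R L1 by (intro mult_strict_left_mono) (auto simp: E_def)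
  also have "\<dots> = (real L - 1) * ln (V / N) / 2 - ln L / 2 - E"
    using scale[OF L1] by simp
  \<comment> \<open>The \<open>ln (V / N) / 2\<close> from the last logarithm turns the factor
    \<open>L / 2\<close> into \<open>(L - 1) / 2\<close>, matching the factor \<open>L - 1\<close>
    in front of \<open>R\<close>.\<close>
  finally have "(real L - 1) * R + (E - L / 2 * ln (V / N) - (- ln L - ln (V / N)) / 2) < 0"
    by (simp add: algebra_simps add_divide_distrib diff_divide_distrib)
  then have "(real L - 1) * R + (k * L * (V + \<delta>) - u * L\<^sup>2 * (V - \<delta> - N) - L / 2 * ln (1 + 2 * k * V)
          - ln (1 - 2 * L * u * V / (1 + 2 * k * V)) / 2) < 0"
    unfolding ln unfolding lin E_def[symmetric] k(2) .
  moreover have "2 * L * u * V < 1 + 2 * k * V" unfolding k(2) u(2) using \<delta> by simp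
  ultimately have "ereal R \<le> avg_rad_LD_capacity (V + \<delta>) N L"
    using \<open>L > 1\<close> \<open>N > 0\<close> \<open>R \<ge> 0\<close> V(1) k(1) u(1) \<delta>(1) by (intro avg_rad_LD_capacity_ge) auto
  then show ?thesis by (simp add: V_def \<delta>_def)
qed

section \<open>The limit in the list size\<close>

theorem mainTheorem1:
  fixes P N :: real
  assumes "P > 0" and "N > 0"
  shows "((\<lambda>L. avg_rad_LD_capacity P N L) \<longlongrightarrow> ereal (max 0 ((1/2) * ln (P / N)))) sequentially"
proof (cases "N < P")
  case False
  \<comment> \<open>Here the logarithm is nonpositive, and the capacity is exactly 0 for every
    \<open>L > 0\<close>: codes have fewer than \<open>L\<close> elements, and the empty code has
    rate 0.\<close>
  then have "max 0 ((1/2) * ln (P / N)) = 0" using assms by (simp add: max_def)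
  moreover have "\<forall>\<^sub>F L in sequentially. avg_rad_LD_capacity P N L = 0"
    using eventually_gt_at_top[of 0]
    by eventually_elim (use False in \<open>auto intro!: antisym avg_rad_LD_capacity_le_0 avg_rad_LD_capacity_nonneg\<close>)
  ultimately show ?thesis by (simp add: tendsto_eventually zero_ereal_def)
next
  case True
  then have pos: "(1/2) * ln (P / N) > 0" using assms by simp
  \<comment> \<open>The explicit lower bound on the capacity, reduced by \<open>1 / L\<close> to
    meet its strict inequality; all corrections vanish as \<open>L\<close> grows.\<close>
  define R where "R L = ln ((P - 1 / real L) / N) / 2 - ln L / (2 * (real L - 1))
    - (2 * (P - 1 / real L) / N - 1 - 1 / L + (P - 1 / real L) - N) / (2 * (P - 1 / real L) * (real L - 1)) - 1 / L" for L :: nat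
  have lim: "(R \<longlongrightarrow> (1/2) * ln (P / N)) sequentially"
    unfolding R_def using assms by real_asymp (simp only: divide_inverse mult_1 mult.commute)
  have "((\<lambda>L. P - 1 / real L) \<longlongrightarrow> P) sequentially" by real_asymp
  then have evV: "\<forall>\<^sub>F L in sequentially. N < P - 1 / real L" using True by (intro order_tendstoD)
  have evR: "\<forall>\<^sub>F L in sequentially. 0 < R L" using lim pos by (intro order_tendstoD)
  have "((\<lambda>L. avg_rad_LD_capacity P N L) \<longlongrightarrow> ereal ((1/2) * ln (P / N))) sequentially"
  proof (rule tendsto_sandwich)
    show "((\<lambda>L. ereal (R L)) \<longlongrightarrow> ereal ((1/2) * ln (P / N))) sequentially" using lim by simp
    show "\<forall>\<^sub>F L in sequentially. ereal (R L) \<le> avg_rad_LD_capacity P N L"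
      using evV evR eventually_gt_at_top[of 1]
      by eventually_elim (use assms in \<open>auto intro!: avg_rad_LD_capacity_ge_explicit simp: R_def\<close>)
    show "\<forall>\<^sub>F L in sequentially. avg_rad_LD_capacity P N L \<le> ereal ((1/2) * ln (P / N))"
      using eventually_gt_at_top[of 0]
      by eventually_elim (rule avg_rad_LD_capacity_le[OF assms(2) True])
  qed auto
  then show ?thesis using pos by (simp add: max_def)
qed

end
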